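(* Let $\mathcal{M}=(S,I,\to,\Pi,\langle\!\langle\cdot\rangle\!\rangle)$ be a labelled transition system with $k$-bounded branching, and let $\sigma_1,\dots,\sigma_k\colon S\to S$ be functions such that $\to\;=\;\bigcup_{i=1}^k \sigma_i$, i.e. for all $s,t\in S$, $s\to t$ iff $t=\sigma_i(s)$ for some $1\le i\le k$. Let $\simeq$ be a label-preserving partition on $\mathcal{M}$. Suppose there exists a function $r\colon S\times S\to\mathbb{N}$ such that, for every $s,t\in S$ with $s\simeq t$, $$\bigwedge_{i=1}^k\Big(\bigvee_{j=1}^k \sigma_i(s)\simeq\sigma_j(t)\;\lor\; \big(s\simeq\sigma_i(s)\land r(\sigma_i(s),\sigma_i(s))<r(s,s)\big)\;\lor\;\bigvee_{j=1}^k\big(t\simeq\sigma_j(t)\land r(\sigma_i(s),\sigma_j(t))<r(\sigma_i(s),t)\big)\Big).$$ Then $\simeq$ is a stutter-insensitive bisimulation on $\mathcal{M}$.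
   Context: A labelled transition system $\mathcal{M}$ consists of a countable state space $S$, an initial region $I\subseteq S$, a transition relation $\to\subseteq S\times S$, a set of atomic propositions $\Pi$, and a labelling function $\langle\!\langle\cdot\rangle\!\rangle\colon S\to\mathcal{P}(\Pi)$. It has $k$-bounded branching ($k\in\mathbb{N}$) if every state $s$ satisfies $0<|\{t\in S: s\to t\}|\le k$. A path is an infinite sequence $s_0s_1\dots$ with $s_i\to s_{i+1}$ for all $i$; $\mathrm{Paths}(s)$ denotes the set of paths with $s_0=s$. A partition on $\mathcal{M}$ is an equivalence relation $\simeq$ on $S$; it is label-preserving if $s\simeq t$ implies $\langle\!\langle s\rangle\!\rangle=\langle\!\langle t\rangle\!\rangle$. A label-preserving partition $\simeq$ is a stutter-insensitive bisimulation if for all $s,s'\in S$ with $s\simeq s'$ and every $\pi\in\mathrm{Paths}(s)$ there exists $\pi'\in\mathrm{Paths}(s')$ such that $\pi$ and $\pi'$ can be split into equally many (consecutive) non-empty finite subsequences $\pi=B_1B_2\dots$ and $\pi'=B_1'B_2'\dots$ with $t\simeq t'$ for all $i$ and all $t\in B_i$, $t'\in B_i'$. *)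

theory Defs
  imports Main "HOL-Library.Countable_Set" "HOL-Library.FuncSet"
begin

record ('s, 'p) lts =
  states :: "'s set"
  init :: "'s set"
  trans_rel :: "('s \<times> 's) set"
  props :: "'p set"
  label :: "'s \<Rightarrow> 'p set"

definition labelled_transition_system :: "('s, 'p) lts \<Rightarrow> bool" where
  "labelled_transition_system M \<longleftrightarrow>
     countable (states M) \<and>
     init M \<subseteq> states M \<and>
     trans_rel M \<subseteq> states M \<times> states M \<and>
     label M \<in> states M \<rightarrow> Pow (props M)"

text \<open>Since \<^const>\<open>card\<close> is 0 on infinite sets, \<open>0 < card _\<close> entails finiteness below.\<close>

definition bounded_branching :: "nat \<Rightarrow> ('s, 'p) lts \<Rightarrow> bool" where
  "bounded_branching k M \<longleftrightarrow>
     (\<forall>s\<in>states M. 0 < card {t \<in> states M. (s, t) \<in> trans_rel M} \<and>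
                    card {t \<in> states M. (s, t) \<in> trans_rel M} \<le> k)"

definition Paths :: "('s, 'p) lts \<Rightarrow> 's \<Rightarrow> (nat \<Rightarrow> 's) set" where
  "Paths M s = {\<pi>. \<pi> 0 = s \<and> (\<forall>i. (\<pi> i, \<pi> (Suc i)) \<in> trans_rel M)}"

definition partition_on_lts :: "('s, 'p) lts \<Rightarrow> ('s \<times> 's) set \<Rightarrow> bool" where
  "partition_on_lts M R \<longleftrightarrow> equiv (states M) R"

definition label_preserving :: "('s, 'p) lts \<Rightarrow> ('s \<times> 's) set \<Rightarrow> bool" where
  "label_preserving M R \<longleftrightarrow> (\<forall>(s, t)\<in>R. label M s = label M t)"

text \<open>\<open>splits_into \<pi> B\<close>: the infinite sequence \<open>\<pi>\<close> is the concatenation \<open>B 0, B 1, \<dots>\<close> of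
  consecutive non-empty finite blocks; \<open>c i\<close> is the position at which block \<open>B i\<close> starts.
  As \<open>\<pi>\<close> is infinite and all blocks are finite, there are always infinitely many blocks, so two
  split paths automatically have equally many.\<close>

definition splits_into :: "(nat \<Rightarrow> 's) \<Rightarrow> (nat \<Rightarrow> 's list) \<Rightarrow> bool" where
  "splits_into \<pi> B \<longleftrightarrow>
     (\<exists>c :: nat \<Rightarrow> nat. c 0 = 0 \<and> strict_mono c \<and> (\<forall>i. B i = map \<pi> [c i..<c (Suc i)]))"

definition stutter_insensitive_bisimulation :: "('s, 'p) lts \<Rightarrow> ('s \<times> 's) set \<Rightarrow> bool" where
  "stutter_insensitive_bisimulation M R \<longleftrightarrow>
     partition_on_lts M R \<and> label_preserving M R \<and>
     (\<forall>s\<in>states M. \<forall>s'\<in>states M. (s, s') \<in> R \<longrightarrow>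
        (\<forall>\<pi>\<in>Paths M s. \<exists>\<pi>'\<in>Paths M s'. \<exists>B B'.
           splits_into \<pi> B \<and> splits_into \<pi>' B' \<and>
           (\<forall>i. \<forall>t\<in>set (B i). \<forall>t'\<in>set (B' i). (t, t') \<in> R)))"

end

theory Submission
  imports Defs
begin

text \<open>Given a path \<open>\<pi>\<close> and a state \<open>t \<simeq> \<pi> m\<close>, the three disjuncts of the ranking condition let
  both sides advance, let only \<open>\<pi>\<close> advance, or let only \<open>t\<close> advance.  The pair
  \<open>(r (\<pi> m, \<pi> m), r (\<pi> (m + 1), t))\<close> decreases lexicographically along the two one-sided moves,
  and these stay within a single equivalence class.  Hence a joint move occurs after finitely many
  steps; cutting both paths at the joint moves gives the matching blocks.\<close>

lemma strict_mono_block_index: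
  fixes c :: "nat \<Rightarrow> nat"
  assumes "strict_mono c" "c 0 = 0"
  shows "\<exists>i. c i \<le> x \<and> x < c (Suc i)"
proof (induction x)
  case 0
  then show ?case using assms strict_monoD[OF assms(1), of 0 "Suc 0"] by (intro exI[of _ 0]) simp
next
  case (Suc x)
  then obtain i where i: "c i \<le> x" "x < c (Suc i)" by blast
  show ?case
  proof (cases "Suc x < c (Suc i)")
    case True
    then show ?thesis using i by (intro exI[of _ i]) simp
  next
    case False
    then have "c (Suc i) = Suc x" using i by simp
    then show ?thesis using strict_monoD[OF assms(1), of "Suc i" "Suc (Suc i)"]
      by (intro exI[of _ "Suc i"]) simp
  qed
qed

lemma strict_mono_block_index_unique:
  fixes c :: "nat \<Rightarrow> nat"
  assumes "strict_mono c" "c i \<le> x" "x < c (Suc i)" "c j \<le> x" "x < c (Suc j)"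
  shows "i = j"
proof -
  have "c i < c (Suc j)" "c j < c (Suc i)" using assms by linarith+
  then have "i < Suc j" "j < Suc i" using assms(1) by (simp_all add: strict_mono_less)
  then show ?thesis by simp
qed

lemma splits_into_concat:
  assumes ne: "\<And>i. B i \<noteq> []"
  shows "\<exists>\<pi>. splits_into \<pi> B"
proof -
  define c where "c i = (\<Sum>j<i. length (B j))" for i
  have c0: "c 0 = 0" by (simp add: c_def)
  have cS: "c (Suc i) = c i + length (B i)" for i by (simp add: c_def)
  have mono: "strict_mono c" using ne by (simp add: strict_mono_Suc_iff cS)
  define idx where "idx x = (SOME i. c i \<le> x \<and> x < c (Suc i))" for x
  have idx: "c (idx x) \<le> x \<and> x < c (Suc (idx x))" for x
    unfolding idx_def by (rule someI_ex) (rule strict_mono_block_index[OF mono c0])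
  have idx_eq: "idx x = i" if "c i \<le> x" "x < c (Suc i)" for x i
    using strict_mono_block_index_unique[OF mono] idx[of x] that by blast
  define \<pi> where "\<pi> x = B (idx x) ! (x - c (idx x))" for x
  have "B i = map \<pi> [c i..<c (Suc i)]" for i
    by (rule nth_equalityI) (simp_all add: cS \<pi>_def idx_eq[of i])
  then show ?thesis unfolding splits_into_def using c0 mono by blast
qed

lemma splits_into_0:
  assumes "splits_into \<pi> B"
  shows "\<pi> 0 = hd (B 0)"
proof -
  obtain c where c: "c 0 = 0" "strict_mono c" "\<forall>i. B i = map \<pi> [c i..<c (Suc i)]"
    using assms unfolding splits_into_def by blast
  then have "0 < c (Suc 0)" using strict_monoD[OF c(2), of 0 "Suc 0"] by simp
  then show ?thesis using c by (simp add: hd_map)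
qed

lemma splits_into_successively:
  assumes split: "splits_into \<pi> B"
    and inner: "\<And>i. successively P (B i)"
    and border: "\<And>i. P (last (B i)) (hd (B (Suc i)))"
  shows "P (\<pi> x) (\<pi> (Suc x))"
proof -
  obtain c where c0: "c 0 = 0" and mono: "strict_mono c"
    and B: "\<And>i. B i = map \<pi> [c i..<c (Suc i)]"
    using split unfolding splits_into_def by blast
  have lt: "c i < c (Suc i)" for i using mono by (simp add: strict_mono_less)
  obtain i where i: "c i \<le> x" "x < c (Suc i)"
    using strict_mono_block_index[OF mono c0] by blast
  show ?thesis
  proof (cases "Suc x < c (Suc i)")
    case True
    then show ?thesis
      using inner[of i] i unfolding successively_conv_nth
      by (auto simp: B dest!: spec[of _ "x - c i"])
  next
    case False
    then have x: "c (Suc i) = Suc x" using i by simp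
    then show ?thesis using border[of i] lt[of i] lt[of "Suc i"] i
      by (simp add: B hd_map last_map hd_upt)
  qed
qed

lemma ranked_matching_blocks:
  fixes r :: "'s \<times> 's \<Rightarrow> nat"
  assumes "sym R" "trans R"
    and step: "\<And>s s' t. (s, t) \<in> R \<Longrightarrow> (s, s') \<in> T \<Longrightarrow>
        (\<exists>t'. (t, t') \<in> T \<and> (s', t') \<in> R)
      \<or> ((s, s') \<in> R \<and> r (s', s') < r (s, s))
      \<or> (\<exists>t'. (t, t') \<in> T \<and> (t, t') \<in> R \<and> r (s', t') < r (s', t))"
    and path: "\<And>i. (\<pi> i, \<pi> (Suc i)) \<in> T"
    and "(\<pi> m, t) \<in> R"
  shows "\<exists>n t' us. m < n \<and> us \<noteq> [] \<and> hd us = t \<and> successively (\<lambda>u v. (u, v) \<in> T) us \<and>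
           (last us, t') \<in> T \<and> (\<pi> n, t') \<in> R \<and> (\<forall>j\<in>{m..<n}. \<forall>u\<in>set us. (\<pi> j, u) \<in> R)"
  using \<open>(\<pi> m, t) \<in> R\<close>
proof (induction "(m, t)" arbitrary: m t
    rule: wf_induct[OF wf_measures[of
      "[\<lambda>(m, t). r (\<pi> m, \<pi> m), \<lambda>(m, t). r (\<pi> (Suc m), t)]"]])
  case 1
  note IH = "1.hyps"[rule_format] and mt = "1.prems"
  consider (both) t' where "(t, t') \<in> T" "(\<pi> (Suc m), t') \<in> R"
    | (left) "(\<pi> m, \<pi> (Suc m)) \<in> R" "r (\<pi> (Suc m), \<pi> (Suc m)) < r (\<pi> m, \<pi> m)"
    | (right) t' where "(t, t') \<in> T" "(t, t') \<in> R" "r (\<pi> (Suc m), t') < r (\<pi> (Suc m), t)"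
    using step[OF mt path[of m]] by blast
  then show ?case
  proof cases
    case both
    then show ?thesis using mt by (intro exI[of _ "Suc m"] exI[of _ t'] exI[of _ "[t]"]) auto
  next
    case left
    have "(\<pi> (Suc m), t) \<in> R" using left(1) mt assms(1,2) by (meson symD transD)
    with IH[of "(Suc m, t)" "Suc m" t] left(2)
    obtain n t' us where *: "Suc m < n" "us \<noteq> []" "hd us = t"
        "successively (\<lambda>u v. (u, v) \<in> T) us" "(last us, t') \<in> T" "(\<pi> n, t') \<in> R"
      and rel: "\<forall>j\<in>{Suc m..<n}. \<forall>u\<in>set us. (\<pi> j, u) \<in> R" by auto
    have "(\<pi> m, u) \<in> R" if "u \<in> set us" for u
      using left(1) rel that *(1) assms(2) by (meson transD atLeastLessThan_iff order_refl)
    then have "\<forall>j\<in>{m..<n}. \<forall>u\<in>set us. (\<pi> j, u) \<in> R"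
      using rel by (metis atLeastLessThan_iff le_neq_implies_less Suc_leI)
    then show ?thesis using * Suc_lessD by blast
  next
    case right
    have "(\<pi> m, t') \<in> R" using right(2) mt assms(2) by (meson transD)
    with IH[of "(m, t')" m t'] right(3)
    obtain n t'' us where *: "m < n" "us \<noteq> []" "hd us = t'"
        "successively (\<lambda>u v. (u, v) \<in> T) us" "(last us, t'') \<in> T" "(\<pi> n, t'') \<in> R"
      and rel: "\<forall>j\<in>{m..<n}. \<forall>u\<in>set us. (\<pi> j, u) \<in> R" by auto
    have "(\<pi> j, t) \<in> R" if "j \<in> {m..<n}" for j
      using rel that *(2,3) right(2) assms(1,2) by (metis hd_in_set symD transD)
    then show ?thesis using * rel right(1)
      by (intro exI[of _ n] exI[of _ t''] exI[of _ "t # us"]) (auto simp: successively_Cons)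
  qed
qed

lemma ranked_matching_path:
  fixes r :: "'s \<times> 's \<Rightarrow> nat"
  assumes "sym R" "trans R"
    and step: "\<And>s s' t. (s, t) \<in> R \<Longrightarrow> (s, s') \<in> T \<Longrightarrow>
        (\<exists>t'. (t, t') \<in> T \<and> (s', t') \<in> R)
      \<or> ((s, s') \<in> R \<and> r (s', s') < r (s, s))
      \<or> (\<exists>t'. (t, t') \<in> T \<and> (t, t') \<in> R \<and> r (s', t') < r (s', t))"
    and path: "\<And>i. (\<pi> i, \<pi> (Suc i)) \<in> T"
    and "(\<pi> 0, t) \<in> R"
  shows "\<exists>\<pi>' B B'. \<pi>' 0 = t \<and> (\<forall>i. (\<pi>' i, \<pi>' (Suc i)) \<in> T) \<and> splits_into \<pi> B \<and>
           splits_into \<pi>' B' \<and> (\<forall>i. \<forall>u\<in>set (B i). \<forall>u'\<in>set (B' i). (u, u') \<in> R)"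
proof -
  let ?block = "\<lambda>m t n t' us. m < n \<and> us \<noteq> [] \<and> hd us = t \<and>
      successively (\<lambda>u v. (u, v) \<in> T) us \<and> (last us, t') \<in> T \<and>
      (\<forall>j\<in>{m..<n}. \<forall>u\<in>set us. (\<pi> j, u) \<in> R)"
  have "\<exists>f. \<forall>i. ((\<pi> (fst (f i)), snd (f i)) \<in> R \<and> (i = 0 \<longrightarrow> f i = (0, t))) \<and>
      (\<exists>us. ?block (fst (f i)) (snd (f i)) (fst (f (Suc i))) (snd (f (Suc i))) us)"
  proof (rule dependent_nat_choice)
    fix x :: "nat \<times> 's" and i :: nat
    assume "(\<pi> (fst x), snd x) \<in> R \<and> (i = 0 \<longrightarrow> x = (0, t))"
    then obtain n t' us where "?block (fst x) (snd x) n t' us" "(\<pi> n, t') \<in> R"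
      using ranked_matching_blocks[where r = r and \<pi> = \<pi>, OF assms(1-4), of "fst x" "snd x"] by blast
    then show "\<exists>y. ((\<pi> (fst y), snd y) \<in> R \<and> (Suc i = 0 \<longrightarrow> y = (0, t))) \<and>
        (\<exists>us. ?block (fst x) (snd x) (fst y) (snd y) us)"
      by (intro exI[of _ "(n, t')"]) auto
  qed (use assms(5) in auto)
  then obtain f B' where f0: "f 0 = (0, t)"
    and blk: "\<And>i. ?block (fst (f i)) (snd (f i)) (fst (f (Suc i))) (snd (f (Suc i))) (B' i)"
    by metis
  define B where "B i = map \<pi> [fst (f i)..<fst (f (Suc i))]" for i
  have "splits_into \<pi> B"
    unfolding splits_into_def B_def using f0 blk
    by (intro exI[of _ "\<lambda>i. fst (f i)"]) (simp add: strict_mono_Suc_iff)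
  moreover obtain \<pi>' where \<pi>': "splits_into \<pi>' B'" using splits_into_concat blk by meson
  moreover have "\<pi>' 0 = t" using splits_into_0[OF \<pi>'] blk[of 0] f0 by simp
  moreover have "(\<pi>' i, \<pi>' (Suc i)) \<in> T" for i
    by (rule splits_into_successively[OF \<pi>', of "\<lambda>u v. (u, v) \<in> T"]) (use blk in auto)
  moreover have "\<forall>i. \<forall>u\<in>set (B i). \<forall>u'\<in>set (B' i). (u, u') \<in> R"
    using blk by (simp add: B_def)
  ultimately show ?thesis by blast
qed

theorem theorem3:
  fixes M :: "('s, 'p) lts"
    and k :: nat
    and \<sigma> :: "nat \<Rightarrow> 's \<Rightarrow> 's"
    and R :: "('s \<times> 's) set"
  assumes "labelled_transition_system M"
    and "bounded_branching k M"
    and "\<forall>i\<in>{1..k}. \<sigma> i \<in> states M \<rightarrow> states M"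
    and "\<forall>s\<in>states M. \<forall>t\<in>states M. (s, t) \<in> trans_rel M \<longleftrightarrow> (\<exists>i\<in>{1..k}. t = \<sigma> i s)"
    and "partition_on_lts M R"
    and "label_preserving M R"
    and "\<exists>r :: 's \<times> 's \<Rightarrow> nat. \<forall>s\<in>states M. \<forall>t\<in>states M. (s, t) \<in> R \<longrightarrow>
           (\<forall>i\<in>{1..k}.
              (\<exists>j\<in>{1..k}. (\<sigma> i s, \<sigma> j t) \<in> R)
            \<or> ((s, \<sigma> i s) \<in> R \<and> r (\<sigma> i s, \<sigma> i s) < r (s, s))
            \<or> (\<exists>j\<in>{1..k}. (t, \<sigma> j t) \<in> R \<and> r (\<sigma> i s, \<sigma> j t) < r (\<sigma> i s, t)))"
  shows "stutter_insensitive_bisimulation M R"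
proof -
  have eq: "equiv (states M) R" using assms(5) by (simp add: partition_on_lts_def)
  then have R: "sym R" "trans R" "R \<subseteq> states M \<times> states M"
    unfolding equiv_def by blast+
  have T: "trans_rel M \<subseteq> states M \<times> states M"
    using assms(1) by (simp add: labelled_transition_system_def)
  have succ: "(t, \<sigma> j t) \<in> trans_rel M" if "t \<in> states M" "j \<in> {1..k}" for t j
    using assms(3,4) that by blast
  obtain r :: "'s \<times> 's \<Rightarrow> nat" where
    r: "\<forall>s\<in>states M. \<forall>t\<in>states M. (s, t) \<in> R \<longrightarrow> (\<forall>i\<in>{1..k}.
          (\<exists>j\<in>{1..k}. (\<sigma> i s, \<sigma> j t) \<in> R)
        \<or> ((s, \<sigma> i s) \<in> R \<and> r (\<sigma> i s, \<sigma> i s) < r (s, s))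
        \<or> (\<exists>j\<in>{1..k}. (t, \<sigma> j t) \<in> R \<and> r (\<sigma> i s, \<sigma> j t) < r (\<sigma> i s, t)))"
    using assms(7) by (elim exE)
  have step: "(\<exists>t'. (t, t') \<in> trans_rel M \<and> (s', t') \<in> R)
      \<or> ((s, s') \<in> R \<and> r (s', s') < r (s, s))
      \<or> (\<exists>t'. (t, t') \<in> trans_rel M \<and> (t, t') \<in> R \<and> r (s', t') < r (s', t))"
    if st: "(s, t) \<in> R" and ss: "(s, s') \<in> trans_rel M" for s s' t
  proof -
    obtain i where i: "i \<in> {1..k}" "s' = \<sigma> i s" using assms(4) T ss by blast
    have mem: "s \<in> states M" "t \<in> states M" using R(3) st by blast+
    show ?thesis using r[rule_format, OF mem st i(1)] succ[OF mem(2)] unfolding i(2) by meson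
  qed
  have "\<exists>\<pi>'\<in>Paths M s'. \<exists>B B'. splits_into \<pi> B \<and> splits_into \<pi>' B' \<and>
      (\<forall>i. \<forall>t\<in>set (B i). \<forall>t'\<in>set (B' i). (t, t') \<in> R)"
    if "(s, s') \<in> R" "\<pi> \<in> Paths M s" for s s' \<pi>
    using ranked_matching_path[where r = r, OF R(1,2) step, of \<pi> s'] that unfolding Paths_def by blast
  then show ?thesis
    using assms(5,6) unfolding stutter_insensitive_bisimulation_def by blast
qed

end
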